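(* Let $n\ge 2$, let $b\in\{1,-1\}$, let $c\ge 0$ and $d$ be real numbers with $\lambda=c-d\neq 0$, and let $Q$ be the real symmetric $n\times n$ tridiagonal matrix with $Q_{11}=Q_{nn}=d$, $Q_{ii}=c$ for $2\le i\le n-1$, $Q_{i,i+1}=Q_{i+1,i}=-b$ for $1\le i\le n-1$, and all other entries $0$. Suppose $Q$ is invertible. If $c\neq 2$, then $$\operatorname{tr}(Q^{-1})=\frac{n(\varphi_+^2r_+^{n-1}+\varphi_-^2r_-^{n-1})}{\kappa_0\kappa}-\frac{2\rho(r_+^n-r_-^n)}{\kappa_0^2\kappa}.$$
   Context: For $c\ne 2$: $r_\pm=(c\pm\sqrt{c^2-4})/2$ (complex numbers if $c<2$, with $\sqrt{c^2-4}=\mathrm{i}\sqrt{4-c^2}$), $\varphi_\pm=r_\pm-\lambda$, $\kappa_0=\varphi_+-\varphi_-=r_+-r_-$, $\kappa=\varphi_+^2r_+^{n-1}-\varphi_-^2r_-^{n-1}$, and $\rho=\varphi_+\varphi_-=1-c\lambda+\lambda^2$. *)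

theory Defs
  imports
    Complex_Main
    "Jordan_Normal_Form.Matrix"
    "Jordan_Normal_Form.Gauss_Jordan_Elimination"
begin

text \<open>Matrix indices start at 0, so the corners \<open>(1,1)\<close> and \<open>(n,n)\<close> are
  \<open>(0,0)\<close> and \<open>(n-1,n-1)\<close>.\<close>

definition Q_mat :: "nat \<Rightarrow> real \<Rightarrow> real \<Rightarrow> real \<Rightarrow> real mat" where
  "Q_mat n b c d = mat n n (\<lambda>(i, j).
     if i = j then (if i = 0 \<or> i = n - 1 then d else c)
     else if j = i + 1 \<or> i = j + 1 then - b
     else 0)"

definition trace_mat :: "'a :: comm_monoid_add mat \<Rightarrow> 'a" where
  "trace_mat A = (\<Sum>i<dim_row A. A $$ (i, i))"

text \<open>On negative reals \<^const>\<open>csqrt\<close> takes the value with positive imaginary part,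
  so for \<open>0 \<le> c < 2\<close> the root below is \<open>\<i> * sqrt (4 - c\<^sup>2)\<close>.\<close>

definition r_plus :: "real \<Rightarrow> complex" where
  "r_plus c = (of_real c + csqrt (of_real (c\<^sup>2 - 4))) / 2"

definition r_minus :: "real \<Rightarrow> complex" where
  "r_minus c = (of_real c - csqrt (of_real (c\<^sup>2 - 4))) / 2"

definition phi_plus :: "real \<Rightarrow> real \<Rightarrow> complex" where
  "phi_plus c lam = r_plus c - of_real lam"

definition phi_minus :: "real \<Rightarrow> real \<Rightarrow> complex" where
  "phi_minus c lam = r_minus c - of_real lam"

definition kappa0 :: "real \<Rightarrow> real \<Rightarrow> complex" where
  "kappa0 c lam = phi_plus c lam - phi_minus c lam"

definition kappa :: "nat \<Rightarrow> real \<Rightarrow> real \<Rightarrow> complex" where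
  "kappa n c lam = (phi_plus c lam)\<^sup>2 * r_plus c ^ (n - 1) - (phi_minus c lam)\<^sup>2 * r_minus c ^ (n - 1)"

definition rho :: "real \<Rightarrow> real \<Rightarrow> complex" where
  "rho c lam = phi_plus c lam * phi_minus c lam"

end

theory Submission
  imports Defs
begin

text \<open>Let \<open>u\<close> solve the three-term recurrence of the interior rows together with the first row
  (up to the signs \<open>b^i\<close>). By reflection symmetry \<open>u (n - 1 - i)\<close> solves the last row, so
  \<open>Q\<close> has a Green's matrix with entries \<open>b^(i+j) u (min i j) u (n - 1 - max i j)\<close> and
  \<open>Q * G = D * I\<close>, where \<open>D\<close> is the (constant) discrete Wronskian of the two solutions. Hence
  \<open>D * tr (Q^-1) = (\<Sum>i<n. u i * u (n - 1 - i))\<close>, and the closed form of \<open>u\<close> in terms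
  of the characteristic roots \<open>r_\<plusminus>\<close> turns this sum into two geometric sums and gives
  \<open>D = \<kappa> / \<kappa>\<^sub>0\<close>.\<close>

section \<open>The fundamental solution and its Wronskian\<close>

fun green_seq :: "'a::comm_ring_1 \<Rightarrow> 'a \<Rightarrow> nat \<Rightarrow> 'a" where
  "green_seq c d 0 = 1"
| "green_seq c d (Suc 0) = d"
| "green_seq c d (Suc (Suc k)) = c * green_seq c d (Suc k) - green_seq c d k"

definition green_mat :: "nat \<Rightarrow> real \<Rightarrow> real \<Rightarrow> real \<Rightarrow> real mat" where
  "green_mat n b c d = mat n n (\<lambda>(i, j).
     b ^ (i + j) * green_seq c d (min i j) * green_seq c d (n - 1 - max i j))"

text \<open>By the recurrence the left side does not change when one index goes up by 1 and the
  other down by 1, so it depends only on \<open>i + m\<close>; the right side is its value at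
  \<open>i = 0\<close>. This is why all diagonal entries of \<open>Q * G\<close> agree.\<close>

lemma green_seq_wronskian:
  "green_seq c d (Suc i) * green_seq c d (Suc m) - green_seq c d i * green_seq c d m
    = d * green_seq c d (Suc (i + m)) - green_seq c d (i + m)"
proof (induction i arbitrary: m)
  case 0
  show ?case by simp
next
  case (Suc i)
  have "green_seq c d (Suc (Suc i)) * green_seq c d (Suc m) - green_seq c d (Suc i) * green_seq c d m
    = green_seq c d (Suc i) * green_seq c d (Suc (Suc m)) - green_seq c d i * green_seq c d (Suc m)"
    by (simp add: algebra_simps)
  then show ?case using Suc.IH[of "Suc m"] by simp
qed

section \<open>The Green's matrix of \<open>Q\<close> and the trace of its inverse\<close>

lemma Q_mat_row_sum:
  assumes "i < n"
  shows "(\<Sum>k<n. Q_mat n b c d $$ (i, k) * f k) =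
    (if i = 0 \<or> i = n - 1 then d else c) * f i
    - (if i = 0 then 0 else b * f (i - 1)) - (if i + 1 < n then b * f (i + 1) else 0)"
proof -
  \<comment> \<open>For \<open>i = 0\<close> truncated subtraction makes \<open>i - 1\<close> equal
    to \<open>i\<close>, so the left-neighbour term carries its own guard. For
    \<open>i = n - 1\<close> the right neighbour lies outside the range of the sum.\<close>
  have "(\<Sum>k<n. Q_mat n b c d $$ (i, k) * f k) =
     (\<Sum>k<n. (if k = i then (if i = 0 \<or> i = n - 1 then d else c) * f k else 0)
        - (if k = i - 1 then (if i = 0 then 0 else b * f k) else 0)
        - (if k = i + 1 then b * f k else 0))"
    using assms by (intro sum.cong) (auto simp: Q_mat_def)
  also have "\<dots> = (if i = 0 \<or> i = n - 1 then d else c) * f i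
    - (if i = 0 then 0 else b * f (i - 1)) - (if i + 1 < n then b * f (i + 1) else 0)"
    unfolding sum_subtractf sum.delta[OF finite_lessThan] using assms by auto
  finally show ?thesis .
qed

lemma Q_mat_mult_green_mat:
  assumes n: "n = Suc (Suc m)" and b: "b * b = 1"
  shows "Q_mat n b c d * green_mat n b c d =
    (d * green_seq c d (Suc m) - green_seq c d m) \<cdot>\<^sub>m 1\<^sub>m n"
proof (rule eq_matI)
  fix i j
  assume "i < dim_row ((d * green_seq c d (Suc m) - green_seq c d m) \<cdot>\<^sub>m 1\<^sub>m n)"
    and "j < dim_col ((d * green_seq c d (Suc m) - green_seq c d m) \<cdot>\<^sub>m 1\<^sub>m n)"
  then have i: "i < n" and j: "j < n" by auto
  let ?u = "green_seq c d"
  let ?g = "\<lambda>k. b ^ (k + j) * ?u (min k j) * ?u (n - 1 - max k j)"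
  have b_cancel: "b * (b * x) = x" for x using b by (simp flip: mult.assoc)
  have bsq: "b ^ (k + k) = 1" for k
    using b by (metis power_add power_mult_distrib power_one)
  have "(Q_mat n b c d * green_mat n b c d) $$ (i, j)
      = (\<Sum>k<n. Q_mat n b c d $$ (i, k) * ?g k)"
    using i j by (auto simp: scalar_prod_def green_mat_def Q_mat_def atLeast0LessThan intro!: sum.cong)
  also have "\<dots> = (if i = 0 \<or> i = n - 1 then d else c) * ?g i
    - (if i = 0 then 0 else b * ?g (i - 1)) - (if i + 1 < n then b * ?g (i + 1) else 0)"
    by (rule Q_mat_row_sum[OF i])
  \<comment> \<open>Above the diagonal the row sees only the factor \<open>?u k\<close>, below it
    only \<open>?u (n - 1 - k)\<close>; both are annihilated by the interior recurrence, and the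
    corner rows by \<open>?u 1 = d * ?u 0\<close>. The factor \<open>b\<close> of each off-diagonal
    entry is absorbed by the sign \<open>b ^ (k + j)\<close>. On the diagonal the two solutions meet
    and their Wronskian remains.\<close>
  also have "\<dots> = (if i = j then d * ?u (Suc m) - ?u m else 0)"
  proof (cases i j rule: linorder_cases)
    case less
    then obtain l where l: "j = Suc (i + l)" by (metis less_imp_Suc_add)
    show ?thesis
    proof (cases i)
      case 0
      then show ?thesis using n l by (simp add: b_cancel)
    next
      case (Suc p)
      then show ?thesis using n l j by (simp add: b_cancel algebra_simps)
    qed
  next
    case greater
    then obtain l where l: "i = Suc (j + l)" by (metis less_imp_Suc_add)
    obtain q where q: "n = Suc (i + q)" using i by (metis less_imp_Suc_add)
    show ?thesis
    proof (cases q)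
      case 0
      then show ?thesis using l q by (simp add: b_cancel)
    next
      case (Suc p)
      then show ?thesis using l q by (simp add: b_cancel algebra_simps)
    qed
  next
    case equal
    obtain q where q: "n = Suc (i + q)" using i by (metis less_imp_Suc_add)
    show ?thesis
    proof (cases i)
      case 0
      then show ?thesis using equal n by (simp add: b_cancel)
    next
      case (Suc p)
      note ip = this
      show ?thesis
      proof (cases q)
        case 0
        then have eqs: "i = Suc m" "j = Suc m" "n = Suc (Suc m)" using n q equal by auto
        show ?thesis unfolding eqs using bsq[of m] by (simp add: b_cancel algebra_simps)
      next
        case (Suc r)
        \<comment> \<open>The recurrence merges \<open>c * ?u i - ?u (i - 1)\<close> into
          \<open>?u (i + 1)\<close>, which leaves exactly the left side of
          \<open>green_seq_wronskian\<close>.\<close>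
        then have eqs: "i = Suc p" "j = Suc p" "m = Suc (p + r)" "n = Suc (Suc (Suc (p + r)))"
          using n q ip equal by auto
        show ?thesis
          unfolding eqs using bsq[of p] green_seq_wronskian[of c d "Suc p" r]
          by (simp add: b_cancel algebra_simps)
      qed
    qed
  qed
  finally show "(Q_mat n b c d * green_mat n b c d) $$ (i, j)
      = ((d * ?u (Suc m) - ?u m) \<cdot>\<^sub>m 1\<^sub>m n) $$ (i, j)"
    using i j by simp
qed (auto simp: Q_mat_def green_mat_def)

lemma trace_left_inverse_Q_mat:
  assumes n: "n = Suc (Suc m)" and b: "b * b = 1"
    and P: "P \<in> carrier_mat n n" and PQ: "P * Q_mat n b c d = 1\<^sub>m n"
  defines "D \<equiv> d * green_seq c d (Suc m) - green_seq c d m"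
  shows "D \<noteq> 0" and "D * trace_mat P = (\<Sum>i<n. green_seq c d i * green_seq c d (n - 1 - i))"
proof -
  have Q: "Q_mat n b c d \<in> carrier_mat n n" and G: "green_mat n b c d \<in> carrier_mat n n"
    by (auto simp: Q_mat_def green_mat_def)
  have "green_mat n b c d = P * (Q_mat n b c d * green_mat n b c d)"
    using assoc_mult_mat[OF P Q G] PQ G by simp
  also have "\<dots> = D \<cdot>\<^sub>m P"
    unfolding Q_mat_mult_green_mat[OF n b] D_def[symmetric]
    using P mult_smult_distrib[OF P one_carrier_mat] by simp
  finally have GP: "green_mat n b c d = D \<cdot>\<^sub>m P" .
  have entry: "D * P $$ (i, j) = b ^ (i + j) * green_seq c d (min i j) * green_seq c d (n - 1 - max i j)"
    if "i < n" "j < n" for i j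
    using arg_cong[OF GP, of "\<lambda>A. A $$ (i, j)"] that P by (simp add: green_mat_def)
  \<comment> \<open>The corner entry \<open>(0, n - 1)\<close> of the Green's matrix is the sign
    \<open>b ^ (n - 1)\<close>, hence nonzero, while it equals \<open>D\<close> times an entry of
    \<open>P\<close>.\<close>
  show "D \<noteq> 0"
    using entry[of 0 "n - 1"] b n by auto
  have bsq: "b ^ (k + k) = 1" for k
    using b by (metis power_add power_mult_distrib power_one)
  show "D * trace_mat P = (\<Sum>i<n. green_seq c d i * green_seq c d (n - 1 - i))"
    using P entry bsq by (auto simp: trace_mat_def sum_distrib_left intro!: sum.cong)
qed

section \<open>Closed forms in the characteristic roots\<close>

lemma of_real_green_seq:
  "complex_of_real (green_seq c d k) = green_seq (of_real c) (of_real d) k"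
  by (induction c d k rule: green_seq.induct) auto

text \<open>Since \<open>r * s = 1\<close>, the roots of x^2 - (r + s) x + 1 are \<open>r\<close>
  and \<open>s\<close>, so both sides obey the same recurrence, and they agree at 0 and 1. The
  factor \<open>r - s\<close> stays on the left to avoid division.\<close>

lemma green_seq_closed_form:
  fixes r s l :: "'a::comm_ring_1"
  assumes "r * s = 1"
  shows "(r - s) * green_seq (r + s) (r + s - l) k = (r - l) * r ^ k - (s - l) * s ^ k"
proof (induction k rule: induct_nat_012)
  case (ge2 k)
  have "r * (s * x) = x" "s * (r * x) = x" for x
    using assms by (simp_all flip: mult.assoc add: mult.commute)
  note cancel = this
  have "(r - s) * green_seq (r + s) (r + s - l) (Suc (Suc k))
    = (r + s) * ((r - s) * green_seq (r + s) (r + s - l) (Suc k))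
      - (r - s) * green_seq (r + s) (r + s - l) k"
    by (simp add: algebra_simps)
  also have "\<dots> = (r + s) * ((r - l) * r ^ Suc k - (s - l) * s ^ Suc k)
      - ((r - l) * r ^ k - (s - l) * s ^ k)"
    unfolding ge2 ..
  also have "\<dots> = (r - l) * r ^ Suc (Suc k) - (s - l) * s ^ Suc (Suc k)"
    by (simp add: algebra_simps cancel)
  finally show ?case .
qed (simp_all add: algebra_simps)

text \<open>Two factors \<open>r - s\<close> turn each product into closed forms: the pure powers of
  \<open>r\<close> and of \<open>s\<close> do not depend on \<open>i\<close> and give the term with
  \<open>of_nat n\<close>, while the mixed terms form two geometric sums. The third factor
  \<open>r - s\<close> telescopes each of these to \<open>r ^ n - s ^ n\<close>.\<close>

lemma green_seq_convolution:
  fixes r s l :: "'a::comm_ring_1"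
  assumes rs: "r * s = 1"
  shows "(r - s) ^ 3 * (\<Sum>i<n. green_seq (r + s) (r + s - l) i * green_seq (r + s) (r + s - l) (n - 1 - i))
    = of_nat n * (r - s) * ((r - l)\<^sup>2 * r ^ (n - 1) + (s - l)\<^sup>2 * s ^ (n - 1))
      - 2 * ((r - l) * (s - l)) * (r ^ n - s ^ n)"
proof -
  let ?u = "green_seq (r + s) (r + s - l)"
  have summand: "(r - s)\<^sup>2 * (?u i * ?u (n - 1 - i)) =
      ((r - l)\<^sup>2 * r ^ (n - 1) + (s - l)\<^sup>2 * s ^ (n - 1))
      - (r - l) * (s - l) * (r ^ i * s ^ (n - 1 - i)) - (r - l) * (s - l) * (s ^ i * r ^ (n - 1 - i))"
    if "i < n" for i
  proof -
    have pow: "x ^ (n - 1) = x ^ i * x ^ (n - 1 - i)" for x :: 'a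
      using that by (simp flip: power_add)
    have "(r - s)\<^sup>2 * (?u i * ?u (n - 1 - i)) = ((r - s) * ?u i) * ((r - s) * ?u (n - 1 - i))"
      by (simp add: power2_eq_square algebra_simps)
    then show ?thesis
      unfolding green_seq_closed_form[OF rs] pow by (simp add: power2_eq_square algebra_simps)
  qed
  have geom: "(x - y) * (\<Sum>i<n. x ^ i * y ^ (n - 1 - i)) = x ^ n - y ^ n" for x y :: 'a
    by (simp add: power_diff_sumr2 mult.commute)
  have geom': "(r - s) * (\<Sum>i<n. s ^ i * r ^ (n - 1 - i)) = r ^ n - s ^ n"
    using geom[of s r] by (simp add: algebra_simps)
  have square: "(r - s)\<^sup>2 * (\<Sum>i<n. ?u i * ?u (n - 1 - i)) =
      of_nat n * ((r - l)\<^sup>2 * r ^ (n - 1) + (s - l)\<^sup>2 * s ^ (n - 1))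
      - (r - l) * (s - l) * (\<Sum>i<n. r ^ i * s ^ (n - 1 - i))
      - (r - l) * (s - l) * (\<Sum>i<n. s ^ i * r ^ (n - 1 - i))"
    unfolding sum_distrib_left using summand by (simp add: sum_subtractf)
  have distrib: "e * (N * A - p * X - p * Y) = N * e * A - p * (e * X) - p * (e * Y)"
    for e N A p X Y :: 'a
    by (simp add: algebra_simps)
  have "(r - s) ^ 3 * x = (r - s) * ((r - s)\<^sup>2 * x)" for x
    by (simp add: power3_eq_cube power2_eq_square mult.assoc)
  then have "(r - s) ^ 3 * (\<Sum>i<n. ?u i * ?u (n - 1 - i)) =
      of_nat n * (r - s) * ((r - l)\<^sup>2 * r ^ (n - 1) + (s - l)\<^sup>2 * s ^ (n - 1))
      - (r - l) * (s - l) * ((r - s) * (\<Sum>i<n. r ^ i * s ^ (n - 1 - i)))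
      - (r - l) * (s - l) * ((r - s) * (\<Sum>i<n. s ^ i * r ^ (n - 1 - i)))"
    by (simp only: square distrib)
  then show ?thesis
    unfolding geom geom' by (simp add: algebra_simps)
qed

text \<open>By the recurrence the Wronskian is u (m + 2) - l u (m + 1), which multiplies the two
  terms of the closed form by a second \<open>r - l\<close> and \<open>s - l\<close>. With
  \<open>n = m + 2\<close> the right side is \<open>kappa\<close>.\<close>

lemma green_seq_wronskian_closed_form:
  fixes r s l :: "'a::comm_ring_1"
  assumes rs: "r * s = 1"
  shows "(r - s) * ((r + s - l) * green_seq (r + s) (r + s - l) (Suc m) - green_seq (r + s) (r + s - l) m)
    = (r - l)\<^sup>2 * r ^ Suc m - (s - l)\<^sup>2 * s ^ Suc m"
proof -
  let ?u = "green_seq (r + s) (r + s - l)"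
  have "(r - s) * ((r + s - l) * ?u (Suc m) - ?u m)
    = (r - s) * ?u (Suc (Suc m)) - l * ((r - s) * ?u (Suc m))"
    by (simp add: algebra_simps)
  then show ?thesis
    unfolding green_seq_closed_form[OF rs] by (simp add: power2_eq_square algebra_simps)
qed

section \<open>Vieta's relations for the roots, and the trace formula\<close>

lemma r_plus_add_r_minus: "r_plus c + r_minus c = of_real c"
  by (simp add: r_plus_def r_minus_def field_simps)

lemma r_plus_diff_r_minus: "r_plus c - r_minus c = csqrt (of_real (c\<^sup>2 - 4))"
  by (simp add: r_plus_def r_minus_def field_simps)

lemma r_plus_mult_r_minus: "r_plus c * r_minus c = 1"
proof -
  have "4 * (r_plus c * r_minus c) = (of_real c)\<^sup>2 - (csqrt (of_real (c\<^sup>2 - 4)))\<^sup>2"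
    unfolding r_plus_def r_minus_def by (simp add: power2_eq_square field_simps del: of_real_diff)
  then show ?thesis unfolding power2_csqrt by simp
qed

theorem theorem3:
  fixes n :: nat and b c d lam :: real and Q :: "real mat"
  assumes "n \<ge> 2"
    and "b \<in> {1, -1}"
    and "c \<ge> 0"
    and "lam = c - d"
    and "lam \<noteq> 0"
    and "Q = Q_mat n b c d"
    and "invertible_mat Q"
    and "c \<noteq> 2"
  shows "complex_of_real (trace_mat (the (mat_inverse Q))) =
      of_nat n * ((phi_plus c lam)\<^sup>2 * r_plus c ^ (n - 1) + (phi_minus c lam)\<^sup>2 * r_minus c ^ (n - 1))
        / (kappa0 c lam * kappa n c lam)
      - 2 * rho c lam * (r_plus c ^ n - r_minus c ^ n) / ((kappa0 c lam)\<^sup>2 * kappa n c lam)"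
proof -
  obtain m where n: "n = Suc (Suc m)"
    using assms(1) by (metis add_2_eq_Suc le_Suc_ex)
  have b: "b * b = 1" using assms(2) by auto
  have Q: "Q \<in> carrier_mat n n" using assms(6) by (simp add: Q_mat_def)
  \<comment> \<open>\<open>mat_inverse\<close> returns \<open>None\<close> only for matrices outside
    \<open>Units\<close>, so invertibility has to be restated there before \<open>the\<close> is
    known to yield an inverse.\<close>
  have "Q \<in> Units (ring_mat TYPE(real) n ())"
    using assms(7) Q unfolding invertible_mat_def inverts_mat_def Units_def ring_mat_def
    by clarsimp
      (metis carrier_matD(1) carrier_matD(2) carrier_matI index_mult_mat(2,3) index_one_mat(2,3))
  then obtain P where P: "mat_inverse Q = Some P"
    using mat_inverse(1)[OF Q, of "()"] by (cases "mat_inverse Q") auto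
  have "P * Q_mat n b c d = 1\<^sub>m n" "P \<in> carrier_mat n n"
    using mat_inverse(2)[OF Q P] assms(6) by auto
  note trP = trace_left_inverse_Q_mat[OF n b this(2,1)]

  define r s l where "r = r_plus c" and "s = r_minus c" and "l = complex_of_real lam"
  have rs: "r * s = 1" by (simp add: r_def s_def r_plus_mult_r_minus)
  have c: "complex_of_real c = r + s" by (simp add: r_def s_def r_plus_add_r_minus)
  have d: "complex_of_real d = r + s - l"
    unfolding l_def assms(4) by (simp flip: c)
  \<comment> \<open>With c \<ge> 0 this excludes both values \<plusminus>2 at which the roots
    coincide.\<close>
  have "c\<^sup>2 \<noteq> 2\<^sup>2" using assms(3,8) unfolding power2_eq_iff by linarith
  then have "complex_of_real (c\<^sup>2 - 4) \<noteq> 0" unfolding of_real_eq_0_iff by simp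
  then have r_ne_s: "r - s \<noteq> 0"
    unfolding r_def s_def r_plus_diff_r_minus csqrt_eq_0 .

  define D where "D = d * green_seq c d (Suc m) - green_seq c d m"
  define T where "T = complex_of_real (trace_mat P)"
  have k0: "kappa0 c lam = r - s"
    by (simp add: kappa0_def phi_plus_def phi_minus_def r_def s_def)
  have k: "kappa n c lam = (r - s) * of_real D"
    using green_seq_wronskian_closed_form[OF rs, of l m] n
    by (simp add: kappa_def phi_plus_def phi_minus_def D_def of_real_green_seq c d
        flip: r_def s_def l_def)
  have D0: "complex_of_real D \<noteq> 0" using trP(1) unfolding of_real_eq_0_iff D_def .
  have "of_real D * T = (\<Sum>i<n. green_seq (r + s) (r + s - l) i * green_seq (r + s) (r + s - l) (n - 1 - i))"
    using arg_cong[OF trP(2), of complex_of_real]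
    by (simp only: T_def D_def of_real_mult of_real_sum of_real_green_seq c d)
  then have "(r - s) ^ 3 * (of_real D * T) =
      of_nat n * (r - s) * ((r - l)\<^sup>2 * r ^ (n - 1) + (s - l)\<^sup>2 * s ^ (n - 1))
      - 2 * ((r - l) * (s - l)) * (r ^ n - s ^ n)"
    using green_seq_convolution[OF rs, of l n] by simp
  then have eq: "(r - s) ^ 3 * (of_real D * T) =
      (r - s) * (of_nat n * ((r - l)\<^sup>2 * r ^ (n - 1) + (s - l)\<^sup>2 * s ^ (n - 1)))
      - 2 * ((r - l) * (s - l)) * (r ^ n - s ^ n)"
    by (simp only: mult.assoc mult.left_commute)
  \<comment> \<open>Here \<open>k0\<close> stands for \<open>kappa0\<close>, \<open>E\<close> for
    \<open>D\<close>, and \<open>k0 * E\<close> for \<open>kappa\<close>; both factors are nonzero,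
    so every denominator is genuine.\<close>
  have solve: "T = X / (k0 * (k0 * E)) - Y / (k0\<^sup>2 * (k0 * E))"
    if "k0 ^ 3 * (E * T) = k0 * X - Y" "k0 \<noteq> 0" "E \<noteq> 0" for k0 E X Y :: complex
  proof -
    have "X / (k0 * (k0 * E)) - Y / (k0\<^sup>2 * (k0 * E)) = (k0 * X - Y) / (k0 ^ 3 * E)"
      using that(2,3) by (simp add: field_simps power2_eq_square power3_eq_cube)
    also have "\<dots> = T" using that by (simp flip: that(1))
    finally show ?thesis by simp
  qed
  show ?thesis
    using solve[OF eq r_ne_s D0] unfolding k0 k P
    by (simp add: T_def rho_def phi_plus_def phi_minus_def r_def s_def l_def)
qed

end
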